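(* There exists an affine isometric action $\alpha:\mathbb{R}\curvearrowright\ell_2(\mathbb{C})$ of the additive group $(\mathbb{R},+)$ on $\ell_2(\mathbb{C})$ whose cocycle $b:\mathbb{R}\to\ell_2(\mathbb{C})$ is Lipschitz, solvent, and collapsed.
   Context: $\ell_2(\mathbb{C})$ is the space of square-summable complex sequences, and $\mathbb{R}$ has its usual metric. An affine isometric action $\alpha$ of a group $G$ on a Banach space $Y$ is an action of the form $\alpha_g(y)=\pi_g(y)+b(g)$ for $g\in G$, $y\in Y$, where $\pi:G\curvearrowright Y$ is an action by linear isometries and $b:G\to Y$ is a map; $b$ is called the cocycle of $\alpha$, and $b(g)=\alpha_g(0)$. A map $f:(M,d)\to(N,\partial)$ between metric spaces is solvent if for each $n\in\mathbb{N}$ there is $R>0$ such that for all $x,y\in M$, $d(x,y)\in[R,R+n]$ implies $\partial(f(x),f(y))>n$. It is uncollapsed if there is $t>0$ with $\rho_f(t)>0$, where $\rho_f(t)=\inf\{\partial(f(x),f(y)): d(x,y)\ge t\}$; it is collapsed if it is not uncollapsed. *)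

theory Defs
  imports "HOL-Analysis.Analysis"
begin

section \<open>The space of square-summable complex sequences\<close>

lemma l2_triangle:
  fixes x y :: "nat \<Rightarrow> complex"
  assumes x: "summable (\<lambda>n. (cmod (x n))\<^sup>2)" and y: "summable (\<lambda>n. (cmod (y n))\<^sup>2)"
  shows "summable (\<lambda>n. (cmod (x n + y n))\<^sup>2)"
    and "sqrt (\<Sum>n. (cmod (x n + y n))\<^sup>2)
           \<le> sqrt (\<Sum>n. (cmod (x n))\<^sup>2) + sqrt (\<Sum>n. (cmod (y n))\<^sup>2)"
proof -
  let ?C = "sqrt (\<Sum>n. (cmod (x n))\<^sup>2) + sqrt (\<Sum>n. (cmod (y n))\<^sup>2)"
  have C: "?C \<ge> 0" by (simp add: suminf_nonneg x y)
  have part: "(\<Sum>n<N. (cmod (x n + y n))\<^sup>2) \<le> ?C\<^sup>2" for N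
  proof -
    have "sqrt (\<Sum>n<N. (cmod (x n + y n))\<^sup>2) \<le> sqrt (\<Sum>n<N. (cmod (x n) + cmod (y n))\<^sup>2)"
      by (intro real_sqrt_le_mono sum_mono power_mono norm_triangle_ineq) auto
    also have "\<dots> \<le> sqrt (\<Sum>n<N. (cmod (x n))\<^sup>2) + sqrt (\<Sum>n<N. (cmod (y n))\<^sup>2)"
      using L2_set_triangle_ineq[of "\<lambda>n. cmod (x n)" "\<lambda>n. cmod (y n)" "{..<N}"]
      by (simp add: L2_set_def)
    also have "\<dots> \<le> ?C"
      by (intro add_mono real_sqrt_le_mono sum_le_suminf x y) auto
    finally show ?thesis using sqrt_le_D by blast
  qed
  show s: "summable (\<lambda>n. (cmod (x n + y n))\<^sup>2)"
    by (rule summableI_nonneg_bounded[OF _ part]) auto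
  have "(\<Sum>n. (cmod (x n + y n))\<^sup>2) \<le> ?C\<^sup>2"
    by (rule suminf_le_const[OF s part])
  then show "sqrt (\<Sum>n. (cmod (x n + y n))\<^sup>2) \<le> ?C"
    using C real_le_lsqrt by blast
qed

lemma l2_scale:
  fixes c :: complex and x :: "nat \<Rightarrow> complex"
  assumes "summable (\<lambda>n. (cmod (x n))\<^sup>2)"
  shows "summable (\<lambda>n. (cmod (c * x n))\<^sup>2)"
  using summable_mult[OF assms, of "(cmod c)\<^sup>2"] by (simp add: norm_mult power_mult_distrib)

typedef ell2 = "{x :: nat \<Rightarrow> complex. summable (\<lambda>n. (cmod (x n))\<^sup>2)}"
  morphisms ell2_nth Abs_ell2
  by (rule exI[of _ "\<lambda>_. 0"]) simp

setup_lifting type_definition_ell2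

lemma summable_ell2: "summable (\<lambda>n. (cmod (ell2_nth x n))\<^sup>2)"
  using ell2_nth by blast

lemma ell2_eqI: "(\<And>n. ell2_nth x n = ell2_nth y n) \<Longrightarrow> x = y"
  by (metis ell2_nth_inject ext)

lift_definition ell2_scale :: "complex \<Rightarrow> ell2 \<Rightarrow> ell2" is "\<lambda>c x n. c * x n"
  by (rule l2_scale)

instantiation ell2 :: real_vector
begin

lift_definition zero_ell2 :: ell2 is "\<lambda>_. 0" by simp

lift_definition plus_ell2 :: "ell2 \<Rightarrow> ell2 \<Rightarrow> ell2" is "\<lambda>x y n. x n + y n"
  by (rule l2_triangle(1))

lift_definition uminus_ell2 :: "ell2 \<Rightarrow> ell2" is "\<lambda>x n. - x n" by simp

lift_definition minus_ell2 :: "ell2 \<Rightarrow> ell2 \<Rightarrow> ell2" is "\<lambda>x y n. x n - y n"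
proof -
  fix x y :: "nat \<Rightarrow> complex"
  assume "summable (\<lambda>n. (cmod (x n))\<^sup>2)" "summable (\<lambda>n. (cmod (y n))\<^sup>2)"
  then show "summable (\<lambda>n. (cmod (x n - y n))\<^sup>2)"
    using l2_triangle(1)[of x "\<lambda>n. - y n"] by simp
qed

definition scaleR_ell2 :: "real \<Rightarrow> ell2 \<Rightarrow> ell2" where
  "scaleR_ell2 r x = ell2_scale (complex_of_real r) x"

instance
  by standard
    (auto intro!: ell2_eqI simp: scaleR_ell2_def ell2_scale.rep_eq zero_ell2.rep_eq
      plus_ell2.rep_eq uminus_ell2.rep_eq minus_ell2.rep_eq algebra_simps)

end

instantiation ell2 :: real_normed_vector
begin

definition norm_ell2 :: "ell2 \<Rightarrow> real" where
  "norm_ell2 x = sqrt (\<Sum>n. (cmod (ell2_nth x n))\<^sup>2)"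

definition sgn_ell2 :: "ell2 \<Rightarrow> ell2" where
  "sgn_ell2 x = x /\<^sub>R norm x"

definition dist_ell2 :: "ell2 \<Rightarrow> ell2 \<Rightarrow> real" where
  "dist_ell2 x y = norm (x - y)"

definition uniformity_ell2 :: "(ell2 \<times> ell2) filter" where
  "uniformity_ell2 = (INF e\<in>{0<..}. principal {(x, y). dist x y < e})"

definition open_ell2 :: "ell2 set \<Rightarrow> bool" where
  "open_ell2 U \<longleftrightarrow> (\<forall>x\<in>U. eventually (\<lambda>(x', y). x' = x \<longrightarrow> y \<in> U) uniformity)"

instance
proof
  fix x y :: ell2 and a :: real
  show "norm x = 0 \<longleftrightarrow> x = 0"
  proof
    assume "norm x = 0"
    then have "(\<Sum>n. (cmod (ell2_nth x n))\<^sup>2) = 0" by (simp add: norm_ell2_def)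
    then have "\<forall>n. (cmod (ell2_nth x n))\<^sup>2 = 0"
      using suminf_eq_zero_iff[OF summable_ell2] by simp
    then show "x = 0" by (auto intro!: ell2_eqI simp: zero_ell2.rep_eq)
  qed (simp add: norm_ell2_def zero_ell2.rep_eq)
  show "norm (x + y) \<le> norm x + norm y"
    unfolding norm_ell2_def plus_ell2.rep_eq
    by (rule l2_triangle(2)[OF summable_ell2 summable_ell2])
  show "norm (a *\<^sub>R x) = \<bar>a\<bar> * norm x"
    by (simp add: norm_ell2_def scaleR_ell2_def ell2_scale.rep_eq norm_mult power_mult_distrib
        suminf_mult[OF summable_ell2] real_sqrt_mult)
qed (rule sgn_ell2_def dist_ell2_def uniformity_ell2_def open_ell2_def)+

end

lemma norm_ell2_nth_le: "cmod (ell2_nth x n) \<le> norm x"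
proof -
  have "(\<Sum>k\<in>{n}. (cmod (ell2_nth x k))\<^sup>2) \<le> (\<Sum>k. (cmod (ell2_nth x k))\<^sup>2)"
    by (rule sum_le_suminf[OF summable_ell2]) auto
  then show ?thesis unfolding norm_ell2_def by (simp add: real_le_rsqrt)
qed

lemma sum_le_norm_ell2: "(\<Sum>i<n. (cmod (ell2_nth x i))\<^sup>2) \<le> (norm x)\<^sup>2"
proof -
  have "(norm x)\<^sup>2 = (\<Sum>n. (cmod (ell2_nth x n))\<^sup>2)"
    by (simp add: norm_ell2_def suminf_nonneg summable_ell2)
  then show ?thesis using sum_le_suminf[OF summable_ell2, of "{..<n}" x] by simp
qed

instance ell2 :: banach
proof
  fix X :: "nat \<Rightarrow> ell2"
  assume X: "Cauchy X"
  have "Cauchy (\<lambda>m. ell2_nth (X m) i)" for i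
  proof (rule metric_CauchyI)
    fix e :: real assume "e > 0"
    then obtain M where M: "\<forall>m\<ge>M. \<forall>n\<ge>M. dist (X m) (X n) < e"
      using X unfolding Cauchy_def by blast
    have "dist (ell2_nth (X m) i) (ell2_nth (X n) i) \<le> dist (X m) (X n)" for m n
      using norm_ell2_nth_le[of "X m - X n" i] by (simp add: dist_norm minus_ell2.rep_eq)
    then show "\<exists>M. \<forall>m\<ge>M. \<forall>n\<ge>M. dist (ell2_nth (X m) i) (ell2_nth (X n) i) < e"
      using M by (meson le_less_trans)
  qed
  then have "\<exists>l. \<forall>i. (\<lambda>m. ell2_nth (X m) i) \<longlonglongrightarrow> l i"
    by (intro choice allI) (simp add: Cauchy_convergent_iff convergent_def)
  then obtain l where l: "\<And>i. (\<lambda>m. ell2_nth (X m) i) \<longlonglongrightarrow> l i" by blast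
  have tail: "\<exists>M. \<forall>m\<ge>M. \<forall>n. (\<Sum>i<n. (cmod (ell2_nth (X m) i - l i))\<^sup>2) \<le> e\<^sup>2"
    if e: "e > 0" for e :: real
  proof -
    obtain M where M: "\<forall>m\<ge>M. \<forall>k\<ge>M. dist (X m) (X k) < e"
      using X e unfolding Cauchy_def by blast
    have "(\<Sum>i<n. (cmod (ell2_nth (X m) i - l i))\<^sup>2) \<le> e\<^sup>2" if m: "m \<ge> M" for m n
    proof (rule LIMSEQ_le_const2)
      show "(\<lambda>k. \<Sum>i<n. (cmod (ell2_nth (X m) i - ell2_nth (X k) i))\<^sup>2)
              \<longlonglongrightarrow> (\<Sum>i<n. (cmod (ell2_nth (X m) i - l i))\<^sup>2)"
        by (intro tendsto_intros l)
      have "(\<Sum>i<n. (cmod (ell2_nth (X m) i - ell2_nth (X k) i))\<^sup>2) \<le> e\<^sup>2" if "k \<ge> M" for k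
      proof -
        have "(norm (X m - X k))\<^sup>2 \<le> e\<^sup>2"
          using M m that by (intro power_mono) (auto simp: dist_norm less_imp_le)
        then show ?thesis
          using sum_le_norm_ell2[where x = "X m - X k" and n = n] by (simp add: minus_ell2.rep_eq)
      qed
      then show "\<exists>N. \<forall>k\<ge>N. (\<Sum>i<n. (cmod (ell2_nth (X m) i - ell2_nth (X k) i))\<^sup>2) \<le> e\<^sup>2"
        by blast
    qed
    then show ?thesis by blast
  qed
  have diff: "summable (\<lambda>i. (cmod (ell2_nth (X m) i - l i))\<^sup>2)"
    if "\<forall>n. (\<Sum>i<n. (cmod (ell2_nth (X m) i - l i))\<^sup>2) \<le> e\<^sup>2" for m and e :: real
    using that by (intro summableI_nonneg_bounded[where x = "e\<^sup>2"]) auto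
  obtain M where M: "\<forall>n. (\<Sum>i<n. (cmod (ell2_nth (X M) i - l i))\<^sup>2) \<le> 1\<^sup>2"
    using tail[of 1] by auto
  have "summable (\<lambda>i. (cmod (- (ell2_nth (X M) i - l i)))\<^sup>2)"
    by (subst norm_minus_cancel) (rule diff[OF M])
  from l2_triangle(1)[OF this summable_ell2[of "X M"]]
  have "summable (\<lambda>i. (cmod (l i))\<^sup>2)" by simp
  then have nth: "ell2_nth (Abs_ell2 l) = l" by (simp add: Abs_ell2_inverse)
  have "X \<longlonglongrightarrow> Abs_ell2 l"
  proof (rule metric_LIMSEQ_I)
    fix e :: real assume e: "e > 0"
    obtain M where M: "\<forall>m\<ge>M. \<forall>n. (\<Sum>i<n. (cmod (ell2_nth (X m) i - l i))\<^sup>2) \<le> (e/2)\<^sup>2"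
      using tail[of "e/2"] e by auto
    have "dist (X m) (Abs_ell2 l) < e" if m: "m \<ge> M" for m
    proof -
      have b: "\<forall>n. (\<Sum>i<n. (cmod (ell2_nth (X m) i - l i))\<^sup>2) \<le> (e/2)\<^sup>2" using M m by blast
      have "(\<Sum>i. (cmod (ell2_nth (X m) i - l i))\<^sup>2) \<le> (e/2)\<^sup>2"
        using b by (intro suminf_le_const diff[OF b]) auto
      then have "norm (X m - Abs_ell2 l) \<le> e/2"
        unfolding norm_ell2_def minus_ell2.rep_eq nth using e by (intro real_le_lsqrt) auto
      then show ?thesis using e by (simp add: dist_norm)
    qed
    then show "\<exists>no. \<forall>n\<ge>no. dist (X n) (Abs_ell2 l) < e" by blast
  qed
  then show "convergent X" by (auto simp: convergent_def)
qed

interpretation ell2: vector_space ell2_scale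
  by standard (auto intro!: ell2_eqI simp: ell2_scale.rep_eq plus_ell2.rep_eq algebra_simps)

lemma norm_ell2_scale: "norm (ell2_scale c x) = cmod c * norm x"
  by (simp add: norm_ell2_def ell2_scale.rep_eq norm_mult power_mult_distrib
      suminf_mult[OF summable_ell2] real_sqrt_mult)


section \<open>Affine isometric actions\<close>

text \<open>Groups are written additively: \<^class>\<open>group_add\<close> does not assume commutativity.
  The scalar multiplication of the space is a parameter, since the library's normed spaces are
  only equipped with real scalars.\<close>

definition is_action :: "('g::group_add \<Rightarrow> 'y \<Rightarrow> 'y) \<Rightarrow> bool" where
  "is_action \<alpha> \<longleftrightarrow> (\<forall>y. \<alpha> 0 y = y) \<and> (\<forall>g h y. \<alpha> (g + h) y = \<alpha> g (\<alpha> h y))"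

definition linear_isometric_action ::
    "('k::field \<Rightarrow> 'y \<Rightarrow> 'y) \<Rightarrow> ('g::group_add \<Rightarrow> 'y::banach \<Rightarrow> 'y) \<Rightarrow> bool" where
  "linear_isometric_action sc \<pi> \<longleftrightarrow>
     is_action \<pi> \<and> (\<forall>g. Vector_Spaces.linear sc sc (\<pi> g) \<and> (\<forall>y. norm (\<pi> g y) = norm y))"

definition affine_isometric_action ::
    "('k::field \<Rightarrow> 'y \<Rightarrow> 'y) \<Rightarrow> ('g::group_add \<Rightarrow> 'y::banach \<Rightarrow> 'y) \<Rightarrow> bool" where
  "affine_isometric_action sc \<alpha> \<longleftrightarrow>
     is_action \<alpha> \<and>
     (\<exists>\<pi> b. linear_isometric_action sc \<pi> \<and> (\<forall>g y. \<alpha> g y = \<pi> g y + b g))"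

definition cocycle :: "('g::group_add \<Rightarrow> 'y::banach \<Rightarrow> 'y) \<Rightarrow> 'g \<Rightarrow> 'y" where
  "cocycle \<alpha> g = \<alpha> g 0"

lemma cocycle_unique:
  assumes "linear_isometric_action sc \<pi>" and "\<forall>g y. \<alpha> g y = \<pi> g y + b g"
  shows "cocycle \<alpha> = b"
proof
  fix g
  have "norm (\<pi> g 0) = 0" using assms(1) by (simp add: linear_isometric_action_def)
  then show "cocycle \<alpha> g = b g" using assms(2) by (simp add: cocycle_def)
qed


section \<open>Solvent and collapsed maps\<close>

definition solvent :: "('m::metric_space \<Rightarrow> 'n::metric_space) \<Rightarrow> bool" where
  "solvent f \<longleftrightarrow>
     (\<forall>n::nat. \<exists>R>0. \<forall>x y. dist x y \<in> {R..R + real n} \<longrightarrow> dist (f x) (f y) > real n)"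

text \<open>The infimum is taken in \<^typ>\<open>ereal\<close>, so that it is \<open>\<infinity>\<close> when no two points are at
  distance at least \<open>t\<close>.\<close>

definition compression_modulus :: "('m::metric_space \<Rightarrow> 'n::metric_space) \<Rightarrow> real \<Rightarrow> ereal" where
  "compression_modulus f t = Inf {ereal (dist (f x) (f y)) | x y. dist x y \<ge> t}"

definition uncollapsed :: "('m::metric_space \<Rightarrow> 'n::metric_space) \<Rightarrow> bool" where
  "uncollapsed f \<longleftrightarrow> (\<exists>t>0. compression_modulus f t > 0)"

definition collapsed :: "('m::metric_space \<Rightarrow> 'n::metric_space) \<Rightarrow> bool" where
  "collapsed f \<longleftrightarrow> \<not> uncollapsed f"

end

theory Submission
  imports Defs
begin

text \<open>Let the \<open>k\<close>-th coordinate turn about the point \<open>- w k\<close> with angular speed \<open>\<theta> k\<close>. The orbit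
  of the origin is \<open>b t = (w k * (cis (\<theta> k * t) - 1))\<^sub>k\<close>, which lies in the space and is Lipschitz in
  \<open>t\<close> as soon as \<open>w k * \<theta> k\<close> is square-summable, and \<open>\<parallel>b s - b t\<parallel> = \<parallel>b (s - t)\<parallel>\<close>; so only the
  function \<open>u \<mapsto> \<parallel>b u\<parallel>\<close> matters.

  Take the period of the \<open>k\<close>-th coordinate to be \<open>T k = 4 ^ k\<^sup>2\<close> and its radius to be
  \<open>w k = 2 ^ k\<close>. These periods divide one another and grow much faster than the radii.
  Around half a period, for \<open>\<bar>u\<bar>\<close> in \<open>[T n / 4, 3 T n / 4]\<close>, the \<open>n\<close>-th coordinate alone has modulus
  at least its radius \<open>2 ^ n > n\<close>, and this window is longer than \<open>n\<close>: the cocycle is solvent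
  (\<open>winding_large\<close>). After a full period \<open>u = T m\<close>, all coordinates \<open>k \<le> m\<close> are back at the origin,
  while the slower ones contribute a vector whose norm tends to \<open>0\<close> as \<open>m\<close> grows: the cocycle
  returns arbitrarily close to the origin at arbitrarily late times (\<open>winding_period_small\<close>), so it
  is collapsed.\<close>

section \<open>Coordinatewise rotations about points outside the space\<close>

lift_definition rotation :: "(nat \<Rightarrow> real) \<Rightarrow> real \<Rightarrow> ell2 \<Rightarrow> ell2"
  is "\<lambda>\<theta> t y k. cis (\<theta> k * t) * y k"
  by (simp add: norm_mult)

lemma linear_isometric_action_rotation: "linear_isometric_action ell2_scale (rotation \<theta>)"
proof -
  have "is_action (rotation \<theta>)"
    unfolding is_action_def
    by (auto intro!: ell2_eqI simp: rotation.rep_eq cis_mult algebra_simps simp flip: mult.assoc)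
  moreover have "Vector_Spaces.linear ell2_scale ell2_scale (rotation \<theta> t)" for t
    by unfold_locales
      (auto intro!: ell2_eqI
        simp: rotation.rep_eq plus_ell2.rep_eq ell2_scale.rep_eq algebra_simps)
  moreover have "norm (rotation \<theta> t y) = norm y" for t y
    by (simp add: norm_ell2_def rotation.rep_eq norm_mult)
  ultimately show ?thesis by (simp add: linear_isometric_action_def)
qed

text \<open>When \<open>w\<close> is square-summable, this is the coboundary of \<open>w\<close>: the action then fixes \<open>- w\<close> and
  has bounded orbits. The interest lies in weights for which only the differences
  \<open>w k * (cis (\<theta> k * t) - 1)\<close> are square-summable.\<close>

definition winding :: "(nat \<Rightarrow> complex) \<Rightarrow> (nat \<Rightarrow> real) \<Rightarrow> real \<Rightarrow> ell2" where
  "winding w \<theta> t = Abs_ell2 (\<lambda>k. w k * (cis (\<theta> k * t) - 1))"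

lemma norm_cis_minus_1_le: "cmod (cis x - 1) \<le> \<bar>x\<bar>"
proof -
  have "cmod (cis x - 1) = 2 * \<bar>sin (x / 2)\<bar>"
    using dist_exp_i_1[of x] by (simp add: cis_conv_exp)
  also have "\<dots> \<le> \<bar>x\<bar>"
    using abs_sin_x_le_abs_x[of "x / 2"] by simp
  finally show ?thesis .
qed

context
  fixes w :: "nat \<Rightarrow> complex" and \<theta> :: "nat \<Rightarrow> real"
  assumes speeds: "summable (\<lambda>k. (cmod (w k) * \<theta> k)\<^sup>2)"
begin

text \<open>An arc is at least as long as its chord, so square-summable speeds keep the orbit of the origin
  inside the space.\<close>

lemma winding_nth: "ell2_nth (winding w \<theta> t) k = w k * (cis (\<theta> k * t) - 1)"
proof -
  have "(cmod (w k * (cis (\<theta> k * t) - 1)))\<^sup>2 \<le> (cmod (w k) * \<theta> k)\<^sup>2 * t\<^sup>2" for k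
  proof -
    have "cmod (w k * (cis (\<theta> k * t) - 1)) \<le> cmod (w k) * \<bar>\<theta> k * t\<bar>"
      by (simp only: norm_mult) (intro mult_left_mono norm_cis_minus_1_le norm_ge_zero)
    then have "(cmod (w k * (cis (\<theta> k * t) - 1)))\<^sup>2 \<le> (cmod (w k) * \<bar>\<theta> k * t\<bar>)\<^sup>2"
      by (intro power_mono) auto
    then show ?thesis by (simp add: power_mult_distrib mult_ac)
  qed
  then have "summable (\<lambda>k. (cmod (w k * (cis (\<theta> k * t) - 1)))\<^sup>2)"
    by (intro summable_comparison_test'[OF summable_mult2[OF speeds, of "t\<^sup>2"]]) simp
  then show ?thesis by (simp add: winding_def Abs_ell2_inverse)
qed

lemma winding_add: "winding w \<theta> (s + t) = rotation \<theta> s (winding w \<theta> t) + winding w \<theta> s"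
  by (rule ell2_eqI)
    (simp add: winding_nth rotation.rep_eq plus_ell2.rep_eq algebra_simps flip: cis_mult)

lemma winding_zero: "winding w \<theta> 0 = 0"
  by (rule ell2_eqI) (simp add: winding_nth zero_ell2.rep_eq)

lemma affine_isometric_action_winding:
  "affine_isometric_action ell2_scale (\<lambda>t y. rotation \<theta> t y + winding w \<theta> t)"
proof -
  have rot: "rotation \<theta> 0 y = y" "rotation \<theta> (s + t) y = rotation \<theta> s (rotation \<theta> t y)"
    "rotation \<theta> s (x + y) = rotation \<theta> s x + rotation \<theta> s y" for s t x y
    using linear_isometric_action_rotation[of \<theta>]
    by (auto simp: linear_isometric_action_def is_action_def Vector_Spaces.linear_iff)
  have "is_action (\<lambda>t y. rotation \<theta> t y + winding w \<theta> t)"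
    by (simp add: is_action_def rot winding_add winding_zero add.assoc)
  with linear_isometric_action_rotation show ?thesis
    unfolding affine_isometric_action_def by blast
qed

lemma cocycle_winding: "cocycle (\<lambda>t y. rotation \<theta> t y + winding w \<theta> t) = winding w \<theta>"
  by (rule cocycle_unique[OF linear_isometric_action_rotation[of \<theta>]]) simp

lemma dist_winding: "dist (winding w \<theta> s) (winding w \<theta> t) = norm (winding w \<theta> (s - t))"
proof -
  have "winding w \<theta> s - winding w \<theta> t = rotation \<theta> t (winding w \<theta> (s - t))"
    using winding_add[of t "s - t"] by simp
  then show ?thesis
    using linear_isometric_action_rotation[of \<theta>]
    by (simp add: dist_norm linear_isometric_action_def)
qed

end

section \<open>Sparse periods and slowly growing radii\<close>

definition radius :: "nat \<Rightarrow> complex" where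
  "radius k = 2 ^ k"

text \<open>The square in the exponent makes the ratio of consecutive periods outgrow the radii, and the
  base \<open>4\<close> leaves room for the geometric factors in \<open>radius_period_ratio_le\<close>.\<close>

definition period :: "nat \<Rightarrow> real" where
  "period k = 4 ^ k\<^sup>2"

definition speed :: "nat \<Rightarrow> real" where
  "speed k = 2 * pi / period k"

lemma period_pos: "period k > 0"
  by (simp add: period_def)

lemma two_power_le_period: "2 ^ k \<le> period k"
proof -
  have "(2::real) ^ k \<le> 2 ^ (2 * k\<^sup>2)"
    by (rule power_increasing) (auto simp: power2_eq_square intro: order_trans[OF le_square])
  then show ?thesis by (simp add: period_def power_mult)
qed

lemma cmod_radius: "cmod (radius k) = 2 ^ k"
  by (simp add: radius_def norm_power)

lemma radius_speed_le: "cmod (radius k) * speed k \<le> 4 * pi * (1 / 2) ^ k"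
proof -
  have "k + k \<le> Suc (2 * k\<^sup>2)"
    by (cases k) (auto simp: power2_eq_square)
  then have "(2::real) ^ (k + k) \<le> 2 ^ Suc (2 * k\<^sup>2)"
    by (intro power_increasing) auto
  then have "(2::real) ^ k * 2 ^ k \<le> 2 * period k"
    by (simp add: period_def power_add power_mult)
  then have "2 ^ k / period k \<le> 2 / 2 ^ k"
    using period_pos[of k] by (simp add: field_simps)
  then have "2 * pi * (2 ^ k / period k) \<le> 2 * pi * (2 / 2 ^ k)"
    by (intro mult_left_mono) auto
  then show ?thesis
    by (simp add: cmod_radius speed_def power_divide algebra_simps)
qed

text \<open>During one period of coordinate \<open>m\<close>, a slower coordinate \<open>k\<close> moves a distance that decays
  geometrically in both indices.\<close>

lemma radius_period_ratio_le:
  assumes "m < k"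
  shows "cmod (radius k) * (period m / period k) \<le> (1 / 2) ^ m * (1 / 2) ^ k"
proof -
  obtain d where d: "k = m + 1 + d"
    using assms less_iff_Suc_add by auto
  have "k + 2 * m\<^sup>2 + m + k \<le> 2 * k\<^sup>2"
    by (simp add: d power2_eq_square algebra_simps)
  then have "(2::real) ^ (k + 2 * m\<^sup>2 + m + k) \<le> 2 ^ (2 * k\<^sup>2)"
    by (intro power_increasing) auto
  then have "2 ^ k * period m * 2 ^ m * 2 ^ k \<le> period k"
    by (simp only: power_add) (simp add: period_def power_mult)
  then show ?thesis
    using period_pos[of k] by (simp add: cmod_radius power_divide field_simps)
qed

lemma summable_speeds: "summable (\<lambda>k. (cmod (radius k) * speed k)\<^sup>2)"
proof (rule summable_comparison_test')
  show "summable (\<lambda>k. (4 * pi)\<^sup>2 * (1 / 4 :: real) ^ k)"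
    by (intro summable_mult summable_geometric) simp
  fix k :: nat
  have "(cmod (radius k) * speed k)\<^sup>2 \<le> (4 * pi * (1 / 2) ^ k)\<^sup>2"
    using radius_speed_le[of k] by (intro power_mono) (auto simp: speed_def period_def)
  also have "\<dots> = (4 * pi)\<^sup>2 * (1 / 4) ^ k"
    by (simp add: power_mult_distrib power2_eq_square flip: power_mult_distrib)
  finally show "norm ((cmod (radius k) * speed k)\<^sup>2) \<le> (4 * pi)\<^sup>2 * (1 / 4) ^ k"
    by simp
qed

lemmas sparse_winding_nth = winding_nth[OF summable_speeds]

text \<open>The crude constant \<open>2\<close> stands for \<open>sqrt (4 / 3)\<close>.\<close>

lemma norm_ell2_le_geometric:
  assumes "c \<ge> 0" and "\<And>k. cmod (ell2_nth x k) \<le> c * (1 / 2) ^ k"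
  shows "norm x \<le> 2 * c"
proof -
  have sums: "(\<lambda>k. c\<^sup>2 * (1 / 4) ^ k) sums (c\<^sup>2 * (1 / (1 - 1 / 4)))"
    by (intro sums_mult geometric_sums) simp
  have "(cmod (ell2_nth x k))\<^sup>2 \<le> c\<^sup>2 * (1 / 4) ^ k" for k
  proof -
    have "(cmod (ell2_nth x k))\<^sup>2 \<le> (c * (1 / 2) ^ k)\<^sup>2"
      by (intro power_mono assms) auto
    also have "\<dots> = c\<^sup>2 * (1 / 4) ^ k"
      by (simp add: power_mult_distrib power2_eq_square flip: power_mult_distrib)
    finally show ?thesis .
  qed
  then have "(\<Sum>k. (cmod (ell2_nth x k))\<^sup>2) \<le> c\<^sup>2 * (1 / (1 - 1 / 4))"
    using suminf_le[OF _ summable_ell2 sums_summable[OF sums]] sums_unique[OF sums] by simp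
  also have "\<dots> \<le> (2 * c)\<^sup>2"
    by (simp add: power2_eq_square)
  finally show ?thesis
    unfolding norm_ell2_def using assms(1) by (intro real_le_lsqrt) auto
qed

lemma norm_winding_le: "norm (winding radius speed u) \<le> 8 * pi * \<bar>u\<bar>"
proof -
  have "norm (winding radius speed u) \<le> 2 * (4 * pi * \<bar>u\<bar>)"
  proof (rule norm_ell2_le_geometric)
    fix k
    have "cmod (ell2_nth (winding radius speed u) k) \<le> cmod (radius k) * \<bar>speed k * u\<bar>"
      by (simp only: sparse_winding_nth norm_mult)
        (intro mult_left_mono norm_cis_minus_1_le norm_ge_zero)
    also have "\<dots> = (cmod (radius k) * speed k) * \<bar>u\<bar>"
      using period_pos[of k] by (simp add: speed_def abs_mult)
    also have "\<dots> \<le> (4 * pi * (1 / 2) ^ k) * \<bar>u\<bar>"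
      by (intro mult_right_mono radius_speed_le) simp
    finally show "cmod (ell2_nth (winding radius speed u) k) \<le> 4 * pi * \<bar>u\<bar> * (1 / 2) ^ k"
      by (simp add: mult_ac)
  qed simp
  then show ?thesis by simp
qed

text \<open>Between a quarter and three quarters of its period, a point on a circle is in the half of the
  circle facing away from its starting point, so its distance from there is at least the radius.\<close>

lemma winding_large:
  assumes "\<bar>u\<bar> \<in> {period n / 4..3 * period n / 4}"
  shows "2 ^ n \<le> norm (winding radius speed u)"
proof -
  have "pi / 2 \<le> speed n * \<bar>u\<bar>" "speed n * \<bar>u\<bar> \<le> 3 * pi / 2"
    using assms period_pos[of n] by (auto simp: speed_def field_simps)
  then have "cos (speed n * \<bar>u\<bar> - pi) \<ge> 0"
    by (intro cos_ge_zero) auto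
  then have "cos (speed n * \<bar>u\<bar>) \<le> 0"
    by simp
  also have "cos (speed n * \<bar>u\<bar>) = cos (speed n * u)"
    by (simp add: abs_if)
  finally have "1 \<le> \<bar>Re (cis (speed n * u) - 1)\<bar>"
    by simp
  also have "\<dots> \<le> cmod (cis (speed n * u) - 1)"
    by (rule abs_Re_le_cmod)
  finally have "2 ^ n \<le> cmod (ell2_nth (winding radius speed u) n)"
    by (simp add: sparse_winding_nth norm_mult cmod_radius)
  also have "\<dots> \<le> norm (winding radius speed u)"
    by (rule norm_ell2_nth_le)
  finally show ?thesis .
qed

text \<open>At time \<open>period m\<close> every coordinate \<open>k \<le> m\<close> has made exactly \<open>period m / period k\<close> full
  turns, a whole number.\<close>

lemma winding_period_small: "norm (winding radius speed (period m)) \<le> 4 * pi * (1 / 2) ^ m"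
proof -
  have "norm (winding radius speed (period m)) \<le> 2 * (2 * pi * (1 / 2) ^ m)"
  proof (rule norm_ell2_le_geometric)
    fix k
    show "cmod (ell2_nth (winding radius speed (period m)) k) \<le> 2 * pi * (1 / 2) ^ m * (1 / 2) ^ k"
    proof (cases "k \<le> m")
      case True
      then have "k\<^sup>2 \<le> m\<^sup>2" by (intro power_mono) auto
      then have "period m / period k = real (4 ^ (m\<^sup>2 - k\<^sup>2))"
        using power_diff[of "4::real" "k\<^sup>2" "m\<^sup>2"] by (simp only: period_def of_nat_power) simp
      then have "speed k * period m = 2 * pi * real (4 ^ (m\<^sup>2 - k\<^sup>2))"
        by (simp add: speed_def flip: times_divide_eq_right)
      then have "cis (speed k * period m) = 1"
        using cis_multiple_2pi[of "real (4 ^ (m\<^sup>2 - k\<^sup>2))"] by (metis Ints_of_nat)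
      then show ?thesis by (simp add: sparse_winding_nth)
    next
      case False
      have "cmod (ell2_nth (winding radius speed (period m)) k)
          \<le> cmod (radius k) * \<bar>speed k * period m\<bar>"
        by (simp only: sparse_winding_nth norm_mult)
          (intro mult_left_mono norm_cis_minus_1_le norm_ge_zero)
      also have "\<dots> = 2 * pi * (cmod (radius k) * (period m / period k))"
        using period_pos[of k] period_pos[of m] by (simp add: speed_def abs_mult)
      also have "\<dots> \<le> 2 * pi * ((1 / 2) ^ m * (1 / 2) ^ k)"
        using False by (intro mult_left_mono radius_period_ratio_le) auto
      finally show ?thesis by (simp add: mult_ac)
    qed
  qed simp
  then show ?thesis by simp
qed

section \<open>Metric properties of the cocycle\<close>

lemma lipschitz_sparse_winding: "(8 * pi)-lipschitz_on UNIV (winding radius speed)"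
  by (rule lipschitz_onI)
    (simp_all add: dist_winding[OF summable_speeds] dist_real_def norm_winding_le)

lemma solvent_sparse_winding: "solvent (winding radius speed)"
  unfolding solvent_def
proof (intro allI exI conjI impI)
  fix n :: nat and x y :: real
  show "period n / 4 > 0" using period_pos[of n] by simp
  assume xy: "dist x y \<in> {period n / 4..period n / 4 + real n}"
  have "real n * 2 \<le> period n"
  proof -
    have "n * 2 \<le> 4 ^ n\<^sup>2"
    proof (cases n)
      case (Suc j)
      have "n < 2 ^ n" by (rule less_exp)
      then have "n * 2 \<le> 2 ^ n * 2 ^ n"
        using Suc by (intro mult_mono) auto
      also have "\<dots> = (4::nat) ^ n"
        by (simp flip: power_mult_distrib)
      also have "\<dots> \<le> 4 ^ n\<^sup>2"
        by (intro power_increasing) (auto simp: power2_eq_square)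
      finally show ?thesis .
    qed simp
    then have "real (n * 2) \<le> real (4 ^ n\<^sup>2)" by (rule of_nat_mono)
    then show ?thesis by (simp add: period_def)
  qed
  then have "2 ^ n \<le> dist (winding radius speed x) (winding radius speed y)"
    unfolding dist_winding[OF summable_speeds]
    using xy by (intro winding_large) (auto simp: dist_real_def)
  moreover have "real n < 2 ^ n" by (rule of_nat_less_two_power)
  ultimately show "real n < dist (winding radius speed x) (winding radius speed y)"
    by linarith
qed

lemma collapsed_sparse_winding: "collapsed (winding radius speed)"
  unfolding collapsed_def uncollapsed_def
proof safe
  fix t :: real
  assume "compression_modulus (winding radius speed) t > 0"
  then obtain e where e: "0 < ereal e" "ereal e < compression_modulus (winding radius speed) t"
    using ereal_dense2 by blast
  have "(\<lambda>m. 4 * pi * (1 / 2) ^ m) \<longlonglongrightarrow> 4 * pi * 0"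
    by (intro tendsto_mult_left LIMSEQ_power_zero) simp
  then have "eventually (\<lambda>m. 4 * pi * (1 / 2) ^ m < e) sequentially"
    using e(1) by (intro order_tendstoD) auto
  moreover have "eventually (\<lambda>m. t \<le> real m) sequentially"
    using filterlim_real_sequentially by (simp add: filterlim_at_top)
  ultimately obtain m where m: "4 * pi * (1 / 2) ^ m < e" "t \<le> real m"
    by (metis (mono_tags, lifting) eventually_conj eventually_happens
        sequentially_bot)
  have "real m < 2 ^ m" by (rule of_nat_less_two_power)
  with m(2) two_power_le_period[of m] have "t \<le> dist (period m) 0"
    unfolding dist_real_def by linarith
  then have "compression_modulus (winding radius speed) t
      \<le> ereal (dist (winding radius speed (period m)) (winding radius speed 0))"
    unfolding compression_modulus_def by (intro Inf_lower) blast
  also have "\<dots> \<le> ereal (4 * pi * (1 / 2) ^ m)"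
    using winding_period_small[of m] by (simp add: dist_winding[OF summable_speeds])
  also have "\<dots> < ereal e" using m(1) by simp
  finally show False using e(2) by simp
qed

theorem proposition2p5:
  shows "\<exists>\<alpha> :: real \<Rightarrow> ell2 \<Rightarrow> ell2.
    affine_isometric_action ell2_scale \<alpha> \<and>
    (\<exists>L. L-lipschitz_on UNIV (cocycle \<alpha>)) \<and>
    solvent (cocycle \<alpha>) \<and>
    collapsed (cocycle \<alpha>)"
proof (intro exI conjI)
  let ?\<alpha> = "\<lambda>t y. rotation speed t y + winding radius speed t"
  note b = cocycle_winding[OF summable_speeds]
  show "affine_isometric_action ell2_scale ?\<alpha>"
    by (rule affine_isometric_action_winding[OF summable_speeds])
  show "(8 * pi)-lipschitz_on UNIV (cocycle ?\<alpha>)"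
    unfolding b by (rule lipschitz_sparse_winding)
  show "solvent (cocycle ?\<alpha>)"
    unfolding b by (rule solvent_sparse_winding)
  show "collapsed (cocycle ?\<alpha>)"
    unfolding b by (rule collapsed_sparse_winding)
qed

end
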